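(* Let $S_1=(X_1,X_1,U_1,U_1,X_1,F_1,\mathrm{id})$ and $S_2=(X_2,X_2,U_2,U_2,X_2,F_2,\mathrm{id})$ be simple systems, let $Q\subseteq X_1\times X_2$ be a feedback refinement relation from $S_1$ to $S_2$, and assume that the system $C$ is feedback composable with $S_2$. Then the following holds. (i) $C$ is feedback composable with $Q\circ S_1$, and $C\circ Q$ is feedback composable with $S_1$. (ii) $\mathcal{B}(C\times(Q\circ S_1))\subseteq\mathcal{B}(C\times S_2)$. (iii) For every $(u,x_1)\in\mathcal{B}((C\circ Q)\times S_1)$ there exists a map $x_2$ such that $(u,x_2)\in\mathcal{B}(C\times S_2)$ and $(x_1(t),x_2(t))\in Q$ for all $t$ in the domain of $x_1$.
   Context: Notation. $\mathbb{N}=\{1,2,\dots\}$, $\mathbb{Z}_+=\{0,1,2,\dots\}$. For $T\in\mathbb{Z}_+\cup\{\infty\}$, $[0;T[\,=\{t\in\mathbb{Z}_+: t<T\}$; $A^{[0;T[}$ is the set of maps $[0;T[\,\to A$. $f\colon A\rightrightarrows B$ denotes a set-valued map, identified with the relation $\{(a,b): b\in f(a)\}\subseteq A\times B$; $f(M)=\bigcup_{a\in M}f(a)$ for $M\subseteq A$; $f$ is strict if $f(a)\neq\emptyset$ for all $a\in A$. Systems. A system is a septuple $S=(X,X_0,U,V,Y,F,H)$ where $X,X_0,U,V,Y$ are nonempty sets, $X_0\subseteq X$, $H\colon X\times U\rightrightarrows Y\times V$ is strict, and $F\colon X\times V\rightrightarrows X$. A solution of $S$ on $[0;T[$, $T\in\mathbb{N}\cup\{\infty\}$,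 is a quadruple $(u,v,x,y)\in U^{[0;T[}\times V^{[0;T[}\times X^{[0;T[}\times Y^{[0;T[}$ with $x(0)\in X_0$, $x(t+1)\in F(x(t),v(t))$ for all $t\in[0;T-1[$, and $(y(t),v(t))\in H(x(t),u(t))$ for all $t\in[0;T[$. $S$ is Moore if $(y,v)\in H(x,u)$ and $u'\in U$ imply that there is $v'$ with $(y,v')\in H(x,u')$. $S$ is simple if $U=V$, $X=Y$, $X_0=X$ and $H=\mathrm{id}$, i.e. $H(x,u)=\{(x,u)\}$. Behavior. $\mathcal{B}(S)$ is the set of pairs $(u,y)$ for which there exist $v,x,T$ such that $(u,v,x,y)$ is a solution of $S$ on $[0;T[$ and, if $T<\infty$, then $F(x(T-1),v(T-1))=\emptyset$. Serial composition with a quantizer. If $S=(X,X,U,U,X,F,\mathrm{id})$ is simple and $Q\colon X\rightrightarrows X'$ is strict, then $Q\circ S=(X,X,U,U,X',F,H')$ with $H'(x,u)=Q(x)\times\{u\}$. If $S=(X,X_0,U,V,Y,F,H)$ is a system, $U'$ a nonempty set and $Q\colon U'\rightrightarrows U$ is strict, then $S\circ Q=(X,X_0,U',V,Y,F,H')$ with $H'(x,u')=H(x,Q(u'))=\bigcup_{u\in Q(u')}H(x,u)$ (this also applies if $Q$ takes its values in a subset of $U$). Feedback composition. Let $S_i=(X_i,X_{i,0},U_i,V_i,Y_i,F_i,H_i)$, $i\in\{1,2\}$, be systems. $S_1$ is feedback composable with $S_2$ if $S_2$ is Moore, $Y_2\subseteq U_1$, $Y_1\subseteq U_2$, and: whenever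 $(y_2,v_2)\in H_2(x_2,y_1)$, $(y_1,v_1)\in H_1(x_1,y_2)$ and $F_2(x_2,v_2)=\emptyset$, then $F_1(x_1,v_1)=\emptyset$. In that case the closed loop is $S_1\times S_2=(X_1\times X_2,X_{1,0}\times X_{2,0},\{0\},V_1\times V_2,Y_1\times Y_2,F_{12},H_{12})$ with $F_{12}(x,v)=F_1(x_1,v_1)\times F_2(x_2,v_2)$ and $H_{12}(x,0)=\{(y,v): (y_1,v_1)\in H_1(x_1,y_2)\wedge(y_2,v_2)\in H_2(x_2,y_1)\}$. Since its input alphabet is $\{0\}$, elements $(0,(y_1,y_2))$ of the behavior of $S_1\times S_2$ are identified with $(y_1,y_2)$. Feedback refinement relation. For a simple system $S$ put $U_S(x)=\{u\in U: F(x,u)\neq\emptyset\}$. For simple systems $S_i=(X_i,X_i,U_i,U_i,X_i,F_i,\mathrm{id})$, $i\in\{1,2\}$, with $U_2\subseteq U_1$, a strict relation $Q\subseteq X_1\times X_2$ is a feedback refinement relation from $S_1$ to $S_2$ if for all $(x_1,x_2)\in Q$: (1) $U_{S_2}(x_2)\subseteq U_{S_1}(x_1)$; (2) $u\in U_{S_2}(x_2)$ implies $Q(F_1(x_1,u))\subseteq F_2(x_2,u)$. *)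

theory Defs
  imports Main "HOL-Library.Extended_Nat"
begin

text \<open>
  A set-valued map from \<open>A\<close> to \<open>B\<close> is represented by its graph, a relation \<open>R \<subseteq> A \<times> B\<close>.
  The value of \<open>R\<close> at \<open>a\<close> is \<open>R `` {a}\<close>, and the graph of the map \<open>a \<in> A \<mapsto> f a\<close> is \<open>Sigma A f\<close>.
\<close>

definition strict_map :: "'a set \<Rightarrow> 'b set \<Rightarrow> ('a \<times> 'b) set \<Rightarrow> bool" where
  "strict_map A B R \<longleftrightarrow> R \<subseteq> A \<times> B \<and> (\<forall>a\<in>A. R `` {a} \<noteq> {})"

record ('x, 'u, 'v, 'y) system =
  states :: "'x set"
  init :: "'x set"
  inputs :: "'u set"
  internals :: "'v set"
  outputs :: "'y set"
  trans_map :: "(('x \<times> 'v) \<times> 'x) set"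
  out_map :: "(('x \<times> 'u) \<times> ('y \<times> 'v)) set"

definition is_system :: "('x, 'u, 'v, 'y) system \<Rightarrow> bool" where
  "is_system S \<longleftrightarrow>
     states S \<noteq> {} \<and> init S \<noteq> {} \<and> inputs S \<noteq> {} \<and> internals S \<noteq> {} \<and> outputs S \<noteq> {} \<and>
     init S \<subseteq> states S \<and>
     strict_map (states S \<times> inputs S) (outputs S \<times> internals S) (out_map S) \<and>
     trans_map S \<subseteq> (states S \<times> internals S) \<times> states S"

definition moore :: "('x, 'u, 'v, 'y) system \<Rightarrow> bool" where
  "moore S \<longleftrightarrow>
     (\<forall>x u y v u'. (y, v) \<in> out_map S `` {(x, u)} \<and> u' \<in> inputs S \<longrightarrow>
        (\<exists>v'. (y, v') \<in> out_map S `` {(x, u')}))"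

definition simple :: "('x, 'u, 'u, 'x) system \<Rightarrow> bool" where
  "simple S \<longleftrightarrow>
     is_system S \<and> inputs S = internals S \<and> states S = outputs S \<and> init S = states S \<and>
     out_map S = Id_on (states S \<times> inputs S)"

definition seg :: "enat \<Rightarrow> nat set" where
  "seg T = {t. enat t < T}"

text \<open>
  Maps from \<open>seg T\<close> to \<open>A\<close> are partial functions with domain exactly \<open>seg T\<close>, so that a
  signal determines its own length.
\<close>

definition signals :: "enat \<Rightarrow> 'a set \<Rightarrow> (nat \<rightharpoonup> 'a) set" where
  "signals T A = {f. dom f = seg T \<and> ran f \<subseteq> A}"

definition is_solution ::
    "('x, 'u, 'v, 'y) system \<Rightarrow> enat \<Rightarrow>
     (nat \<rightharpoonup> 'u) \<Rightarrow> (nat \<rightharpoonup> 'v) \<Rightarrow> (nat \<rightharpoonup> 'x) \<Rightarrow> (nat \<rightharpoonup> 'y) \<Rightarrow> bool" where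
  "is_solution S T u v x y \<longleftrightarrow>
     T \<noteq> 0 \<and>
     u \<in> signals T (inputs S) \<and> v \<in> signals T (internals S) \<and>
     x \<in> signals T (states S) \<and> y \<in> signals T (outputs S) \<and>
     the (x 0) \<in> init S \<and>
     (\<forall>t\<in>seg (T - 1). the (x (t + 1)) \<in> trans_map S `` {(the (x t), the (v t))}) \<and>
     (\<forall>t\<in>seg T. (the (y t), the (v t)) \<in> out_map S `` {(the (x t), the (u t))})"

definition behavior :: "('x, 'u, 'v, 'y) system \<Rightarrow> ((nat \<rightharpoonup> 'u) \<times> (nat \<rightharpoonup> 'y)) set" where
  "behavior S =
     {(u, y). \<exists>v x T. is_solution S T u v x y \<and>
        (\<forall>n. T = enat n \<longrightarrow> trans_map S `` {(the (x (n - 1)), the (v (n - 1)))} = {})}"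

text \<open>
  The graph \<open>Q\<close> does not determine the codomain, which becomes the output alphabet of \<open>Q \<circ> S\<close>;
  it is therefore passed as the argument \<open>X'\<close>.
\<close>

definition quantize_output ::
    "'x' set \<Rightarrow> ('x \<times> 'x') set \<Rightarrow> ('x, 'u, 'u, 'x) system \<Rightarrow> ('x, 'u, 'u, 'x') system" where
  "quantize_output X' Q S =
     \<lparr>states = states S, init = states S, inputs = inputs S, internals = inputs S, outputs = X',
      trans_map = trans_map S,
      out_map = Sigma (states S \<times> inputs S) (\<lambda>(x, u). Q `` {x} \<times> {u})\<rparr>"

definition quantize_input ::
    "('x, 'u, 'v, 'y) system \<Rightarrow> 'u' set \<Rightarrow> ('u' \<times> 'u) set \<Rightarrow> ('x, 'u', 'v, 'y) system" where
  "quantize_input S U' Q =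
     \<lparr>states = states S, init = init S, inputs = U', internals = internals S, outputs = outputs S,
      trans_map = trans_map S,
      out_map = Sigma (states S \<times> U') (\<lambda>(x, u'). \<Union>u\<in>Q `` {u'}. out_map S `` {(x, u)})\<rparr>"

definition feedback_composable ::
    "('x1, 'y2, 'v1, 'y1) system \<Rightarrow> ('x2, 'y1, 'v2, 'y2) system \<Rightarrow> bool" where
  "feedback_composable S1 S2 \<longleftrightarrow>
     is_system S1 \<and> is_system S2 \<and> moore S2 \<and>
     outputs S2 \<subseteq> inputs S1 \<and> outputs S1 \<subseteq> inputs S2 \<and>
     (\<forall>x1 x2 y1 y2 v1 v2.
        (y2, v2) \<in> out_map S2 `` {(x2, y1)} \<and> (y1, v1) \<in> out_map S1 `` {(x1, y2)} \<and>
        trans_map S2 `` {(x2, v2)} = {} \<longrightarrow> trans_map S1 `` {(x1, v1)} = {})"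

definition closed_loop ::
    "('x1, 'y2, 'v1, 'y1) system \<Rightarrow> ('x2, 'y1, 'v2, 'y2) system \<Rightarrow>
     ('x1 \<times> 'x2, nat, 'v1 \<times> 'v2, 'y1 \<times> 'y2) system" where
  "closed_loop S1 S2 =
     \<lparr>states = states S1 \<times> states S2, init = init S1 \<times> init S2, inputs = {0},
      internals = internals S1 \<times> internals S2, outputs = outputs S1 \<times> outputs S2,
      trans_map =
        Sigma ((states S1 \<times> states S2) \<times> (internals S1 \<times> internals S2))
          (\<lambda>((x1, x2), (v1, v2)). trans_map S1 `` {(x1, v1)} \<times> trans_map S2 `` {(x2, v2)}),
      out_map =
        Sigma ((states S1 \<times> states S2) \<times> {0})
          (\<lambda>((x1, x2), _). {((y1, y2), (v1, v2)).
             (y1, v1) \<in> out_map S1 `` {(x1, y2)} \<and> (y2, v2) \<in> out_map S2 `` {(x2, y1)}})\<rparr>"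

text \<open>
  The behavior of a closed loop with its trivial input signal dropped and its pair-valued output
  signal read as a pair of signals.
\<close>

definition loop_behavior ::
    "('x1, 'y2, 'v1, 'y1) system \<Rightarrow> ('x2, 'y1, 'v2, 'y2) system \<Rightarrow>
     ((nat \<rightharpoonup> 'y1) \<times> (nat \<rightharpoonup> 'y2)) set" where
  "loop_behavior S1 S2 =
     {(map_option fst \<circ> y, map_option snd \<circ> y) | w y. (w, y) \<in> behavior (closed_loop S1 S2)}"

definition admissible :: "('x, 'u, 'u, 'x) system \<Rightarrow> 'x \<Rightarrow> 'u set" where
  "admissible S x = {u \<in> inputs S. trans_map S `` {(x, u)} \<noteq> {}}"

definition feedback_refinement ::
    "('x1 \<times> 'x2) set \<Rightarrow> ('x1, 'u, 'u, 'x1) system \<Rightarrow> ('x2, 'u, 'u, 'x2) system \<Rightarrow> bool" where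
  "feedback_refinement Q S1 S2 \<longleftrightarrow>
     simple S1 \<and> simple S2 \<and> inputs S2 \<subseteq> inputs S1 \<and>
     strict_map (states S1) (states S2) Q \<and>
     (\<forall>(x1, x2)\<in>Q.
        admissible S2 x2 \<subseteq> admissible S1 x1 \<and>
        (\<forall>u\<in>admissible S2 x2. Q `` (trans_map S1 `` {(x1, u)}) \<subseteq> trans_map S2 `` {(x2, u)}))"

end

theory Submission
  imports Defs
begin

text \<open>
  The two concrete closed loops, \<open>C\<close> with \<open>Q \<circ> S\<^sub>1\<close> and \<open>C \<circ> Q\<close> with \<open>S\<^sub>1\<close>, have the same runs: it
  only matters that the controller reads some abstract state \<open>x\<^sub>2(t) \<in> Q(x\<^sub>1(t))\<close>, not which side of
  the loop picks it. The only difference is whether the output signal records \<open>x\<^sub>2\<close> or \<open>x\<^sub>1\<close>.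
  So the third claim reduces to the second by choosing, at each time, an abstract state that
  explains the controller output (lemma \<open>loop_run_move_quantizer\<close>).

  For the second claim (lemma \<open>loop_run_abstract\<close>), the signal \<open>x\<^sub>2\<close> of abstract states is itself a
  state trajectory of \<open>S\<^sub>2\<close>. Whenever the concrete loop makes a transition, the controller is not
  blocked, so, as \<open>C\<close> is composable with \<open>S\<^sub>2\<close>, the current input is admissible for \<open>S\<^sub>2\<close> at
  \<open>x\<^sub>2(t)\<close>, and the refinement relation turns the concrete transition into an abstract one. When the
  concrete loop stops, one of its components is blocked. Composability says that a blocked plant
  implies a blocked controller, so the controller is blocked in any case, and the abstract loop stops
  at the same time. This is what makes maximal runs correspond to maximal runs.

  Composability of the concrete loops (lemmas \<open>composable_quantize_output\<close> and
  \<open>composable_quantize_input\<close>) rests on one fact (lemma \<open>refinement_blocked\<close>): an input from the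
  abstract alphabet that blocks a concrete state blocks every related abstract state.
\<close>

section \<open>Runs of closed loops\<close>

text \<open>
  Maximal solutions of a closed loop, given by one total function for each component signal; the
  values at times outside \<open>seg T\<close> are irrelevant. Membership in the alphabets is left out because it
  follows from the output equations.
\<close>

definition loop_run ::
    "('x1, 'y2, 'v1, 'y1) system \<Rightarrow> ('x2, 'y1, 'v2, 'y2) system \<Rightarrow> enat \<Rightarrow>
     (nat \<Rightarrow> 'x1) \<Rightarrow> (nat \<Rightarrow> 'x2) \<Rightarrow> (nat \<Rightarrow> 'v1) \<Rightarrow> (nat \<Rightarrow> 'v2) \<Rightarrow>
     (nat \<Rightarrow> 'y1) \<Rightarrow> (nat \<Rightarrow> 'y2) \<Rightarrow> bool" where
  "loop_run A B T xa xb va vb ya yb \<longleftrightarrow>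
     T \<noteq> 0 \<and> xa 0 \<in> init A \<and> xb 0 \<in> init B \<and>
     (\<forall>t. enat (Suc t) < T \<longrightarrow>
        ((xa t, va t), xa (Suc t)) \<in> trans_map A \<and> ((xb t, vb t), xb (Suc t)) \<in> trans_map B) \<and>
     (\<forall>t. enat t < T \<longrightarrow>
        ((xa t, yb t), (ya t, va t)) \<in> out_map A \<and> ((xb t, ya t), (yb t, vb t)) \<in> out_map B) \<and>
     (\<forall>n. T = enat (Suc n) \<longrightarrow>
        trans_map A `` {(xa n, va n)} = {} \<or> trans_map B `` {(xb n, vb n)} = {})"

definition signal :: "enat \<Rightarrow> (nat \<Rightarrow> 'a) \<Rightarrow> (nat \<rightharpoonup> 'a)" where
  "signal T f = (\<lambda>t. if enat t < T then Some (f t) else None)"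

lemma signal_in_signals_iff: "signal T f \<in> signals T A \<longleftrightarrow> (\<forall>t. enat t < T \<longrightarrow> f t \<in> A)"
  by (auto simp: signal_def signals_def seg_def dom_def ran_def)

lemma the_signal [simp]: "enat t < T \<Longrightarrow> the (signal T f t) = f t"
  by (simp add: signal_def)

lemma map_option_signal: "map_option g \<circ> signal T f = signal T (g \<circ> f)"
  by (auto simp: signal_def)

lemma signal_cong: "(\<And>t. enat t < T \<Longrightarrow> f t = g t) \<Longrightarrow> signal T f = signal T g"
  by (auto simp: signal_def)

lemma signals_eq_signal: "f \<in> signals T A \<Longrightarrow> f = signal T (the \<circ> f)"
  by (rule ext) (auto simp: signal_def signals_def seg_def domIff set_eq_iff)

lemma seg_minus_one_iff: "t \<in> seg (T - 1) \<longleftrightarrow> enat (Suc t) < T"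
  by (cases T) (auto simp: seg_def one_enat_def)

lemma enat_Suc_lessD: "enat (Suc t) < T \<Longrightarrow> enat t < T"
  by (cases T) auto

lemma system_out_mapD:
  assumes "is_system S" and "((x, u), (y, v)) \<in> out_map S"
  shows "x \<in> states S" "u \<in> inputs S" "y \<in> outputs S" "v \<in> internals S"
  using assms by (auto simp: is_system_def strict_map_def)

lemma trans_map_closed_loop:
  assumes "is_system A" and "is_system B"
  shows "trans_map (closed_loop A B) `` {((xa, xb), (va, vb))} =
         trans_map A `` {(xa, va)} \<times> trans_map B `` {(xb, vb)}"
  using assms by (auto simp: closed_loop_def is_system_def)

lemma out_map_closed_loop_iff:
  assumes "is_system A" and "is_system B"
  shows "(((xa, xb), w), ((ya, yb), (va, vb))) \<in> out_map (closed_loop A B) \<longleftrightarrow>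
         w = 0 \<and> ((xa, yb), (ya, va)) \<in> out_map A \<and> ((xb, ya), (yb, vb)) \<in> out_map B"
  using system_out_mapD[OF assms(1)] system_out_mapD[OF assms(2)]
  by (auto simp: closed_loop_def)

lemma loop_run_imp_behavior:
  assumes sys: "is_system A" "is_system B"
    and run: "loop_run A B T xa xb va vb ya yb"
  shows "(signal T (\<lambda>_. 0), signal T (\<lambda>t. (ya t, yb t))) \<in> behavior (closed_loop A B)"
proof -
  let ?u = "signal T (\<lambda>_. 0 :: nat)" and ?v = "signal T (\<lambda>t. (va t, vb t))"
    and ?x = "signal T (\<lambda>t. (xa t, xb t))" and ?y = "signal T (\<lambda>t. (ya t, yb t))"
  from run have pos: "enat 0 < T"
    by (auto simp: loop_run_def zero_enat_def[symmetric])
  have out: "((xa t, yb t), (ya t, va t)) \<in> out_map A"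
      "((xb t, ya t), (yb t, vb t)) \<in> out_map B" if "enat t < T" for t
    using run that by (auto simp: loop_run_def)
  note mem = system_out_mapD[OF sys(1) out(1)] system_out_mapD[OF sys(2) out(2)]
  have sol: "is_solution (closed_loop A B) T ?u ?v ?x ?y"
    unfolding is_solution_def signal_in_signals_iff
  proof (intro conjI ballI allI impI)
    show "T \<noteq> 0" using run by (simp add: loop_run_def)
    show "the (?x 0) \<in> init (closed_loop A B)"
      using run pos by (simp add: loop_run_def closed_loop_def)
    fix t assume "t \<in> seg (T - 1)"
    hence t: "enat (Suc t) < T" by (simp add: seg_minus_one_iff)
    have "(xa (Suc t), xb (Suc t)) \<in> trans_map (closed_loop A B) `` {((xa t, xb t), (va t, vb t))}"
      unfolding trans_map_closed_loop[OF sys] using run t by (simp add: loop_run_def)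
    with t enat_Suc_lessD[OF t]
    show "the (?x (t + 1)) \<in> trans_map (closed_loop A B) `` {(the (?x t), the (?v t))}"
      by simp
  next
    fix t assume "t \<in> seg T"
    hence t: "enat t < T" by (simp add: seg_def)
    with out
    show "(the (?y t), the (?v t)) \<in> out_map (closed_loop A B) `` {(the (?x t), the (?u t))}"
      by (simp add: out_map_closed_loop_iff[OF sys])
  qed (use mem in \<open>auto simp: closed_loop_def\<close>)
  have "trans_map (closed_loop A B) `` {(the (?x (n - 1)), the (?v (n - 1)))} = {}"
    if n: "T = enat n" for n
  proof -
    obtain m where m: "n = Suc m" using pos n by (cases n) auto
    have "enat m < T" using n m by simp
    moreover have "trans_map A `` {(xa m, va m)} = {} \<or> trans_map B `` {(xb m, vb m)} = {}"
      using run n m by (auto simp: loop_run_def)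
    ultimately show ?thesis
      using trans_map_closed_loop[OF sys, of "xa m" "xb m" "va m" "vb m"] m by auto
  qed
  with sol show ?thesis unfolding behavior_def by blast
qed

lemma behavior_imp_loop_run:
  assumes sys: "is_system A" "is_system B"
    and beh: "(w, z) \<in> behavior (closed_loop A B)"
  obtains T xa xb va vb ya yb where
    "loop_run A B T xa xb va vb ya yb"
    "w = signal T (\<lambda>_. 0)" "z = signal T (\<lambda>t. (ya t, yb t))"
proof -
  let ?L = "closed_loop A B"
  from beh obtain v x T where sol: "is_solution ?L T w v x z"
    and stop: "\<And>n. T = enat n \<Longrightarrow> trans_map ?L `` {(the (x (n - 1)), the (v (n - 1)))} = {}"
    unfolding behavior_def by blast
  define xa xb va vb ya yb where
    "xa = (\<lambda>t. fst (the (x t)))" and "xb = (\<lambda>t. snd (the (x t)))" and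
    "va = (\<lambda>t. fst (the (v t)))" and "vb = (\<lambda>t. snd (the (v t)))" and
    "ya = (\<lambda>t. fst (the (z t)))" and "yb = (\<lambda>t. snd (the (z t)))"
  note defs = xa_def xb_def va_def vb_def ya_def yb_def
  have pairs: "the (x t) = (xa t, xb t)" "the (v t) = (va t, vb t)" "the (z t) = (ya t, yb t)" for t
    by (simp_all add: defs)
  have out: "((xa t, yb t), (ya t, va t)) \<in> out_map A \<and> ((xb t, ya t), (yb t, vb t)) \<in> out_map B"
      and w0: "the (w t) = 0" if "enat t < T" for t
    using sol that
    by (auto simp: is_solution_def pairs seg_def out_map_closed_loop_iff[OF sys])
  have step: "(xa (Suc t), xb (Suc t)) \<in> trans_map ?L `` {((xa t, xb t), (va t, vb t))}"
    if "enat (Suc t) < T" for t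
    using sol that by (auto simp: is_solution_def pairs seg_minus_one_iff)
  have "T \<noteq> 0" "xa 0 \<in> init A" "xb 0 \<in> init B"
    using sol by (auto simp: is_solution_def pairs closed_loop_def)
  moreover have "((xa t, va t), xa (Suc t)) \<in> trans_map A \<and>
      ((xb t, vb t), xb (Suc t)) \<in> trans_map B"
    if "enat (Suc t) < T" for t
    using step[OF that] unfolding trans_map_closed_loop[OF sys] by simp
  moreover have "trans_map A `` {(xa n, va n)} = {} \<or> trans_map B `` {(xb n, vb n)} = {}"
    if "T = enat (Suc n)" for n
    using stop[OF that] by (simp add: pairs trans_map_closed_loop[OF sys])
  ultimately have "loop_run A B T xa xb va vb ya yb"
    unfolding loop_run_def using out by blast
  moreover have "w = signal T (\<lambda>_. 0)"
    using sol signals_eq_signal[of w T] signal_cong[of T "the \<circ> w" "\<lambda>_. 0"] w0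
    by (fastforce simp: is_solution_def)
  moreover have "z = signal T (\<lambda>t. (ya t, yb t))"
    using sol signals_eq_signal[of z T] by (auto simp: is_solution_def o_def pairs)
  ultimately show ?thesis using that by blast
qed

section \<open>Composability of the concrete closed loops\<close>

lemma simple_out_map: "simple S \<Longrightarrow> out_map S = Id_on (states S \<times> inputs S)"
  by (simp add: simple_def)

lemma is_system_quantize_output:
  assumes "is_system S" and "init S = states S" and "strict_map (states S) X' Q" and "X' \<noteq> {}"
    and "inputs S = internals S"
  shows "is_system (quantize_output X' Q S)"
proof -
  have "out_map (quantize_output X' Q S) `` {(x, u)} = Q `` {x} \<times> {u}"
    if "x \<in> states S" and "u \<in> inputs S" for x u
    using that by (auto simp: quantize_output_def)
  hence "strict_map (states S \<times> inputs S) (X' \<times> inputs S) (out_map (quantize_output X' Q S))"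
    using assms(3) by (auto simp: strict_map_def quantize_output_def)
  thus ?thesis
    using assms by (simp add: is_system_def quantize_output_def)
qed

lemma is_system_quantize_input:
  assumes "is_system S" and "strict_map U' (inputs S) Q" and "U' \<noteq> {}"
  shows "is_system (quantize_input S U' Q)"
proof -
  have "out_map (quantize_input S U' Q) `` {(x, u')} \<noteq> {}" if "x \<in> states S" and "u' \<in> U'" for x u'
  proof -
    obtain u where u: "(u', u) \<in> Q" "u \<in> inputs S"
      using assms(2) \<open>u' \<in> U'\<close> unfolding strict_map_def by blast
    hence "out_map S `` {(x, u)} \<noteq> {}"
      using assms(1) \<open>x \<in> states S\<close> unfolding is_system_def strict_map_def by blast
    with u that show ?thesis unfolding quantize_input_def by fastforce
  qed
  moreover have "out_map (quantize_input S U' Q) \<subseteq> (states S \<times> U') \<times> (outputs S \<times> internals S)"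
    using system_out_mapD[OF assms(1)] by (auto simp: quantize_input_def)
  ultimately have "strict_map (states S \<times> U') (outputs S \<times> internals S)
      (out_map (quantize_input S U' Q))"
    unfolding strict_map_def by blast
  thus ?thesis
    using assms(1,3) by (simp add: is_system_def quantize_input_def)
qed

lemma strict_map_mono: "strict_map A B R \<Longrightarrow> B \<subseteq> B' \<Longrightarrow> strict_map A B' R"
  by (auto simp: strict_map_def)

lemma moore_quantize_output: "moore (quantize_output X' Q S)"
  by (auto simp: moore_def quantize_output_def)

lemma moore_simple: "simple S \<Longrightarrow> moore S"
  by (auto simp: moore_def simple_out_map)

text \<open>The contrapositive of the inclusion between the sets of admissible inputs.\<close>

lemma refinement_blocked:
  assumes "feedback_refinement Q S1 S2" and "(x1, x2) \<in> Q" and "u \<in> inputs S2"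
    and "trans_map S1 `` {(x1, u)} = {}"
  shows "trans_map S2 `` {(x2, u)} = {}"
  using assms unfolding feedback_refinement_def admissible_def by fastforce

text \<open>
  A simple plant passes its input to its transition map and shows its state to the controller, so
  composability can be used without mentioning the output map of the plant.
\<close>

lemma composable_simple_blocked:
  assumes "feedback_composable C S" and "simple S"
    and out: "((xc, x), (u, vc)) \<in> out_map C" and "x \<in> states S"
    and "trans_map S `` {(x, u)} = {}"
  shows "trans_map C `` {(xc, vc)} = {}"
proof -
  have "u \<in> inputs S"
    using assms(1) system_out_mapD(3)[OF _ out] by (auto simp: feedback_composable_def)
  hence "((x, u), (x, u)) \<in> out_map S"
    using assms by (auto simp: simple_out_map)
  with assms show ?thesis
    unfolding feedback_composable_def by (metis Image_singleton_iff)
qed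

text \<open>
  Blocking passes from the concrete plant to the abstract one and from there to the controller. Both
  the composability of the concrete loops and the maximality of the abstract runs come from this.
\<close>

lemma refinement_composable_blocked:
  assumes ref: "feedback_refinement Q S1 S2" and comp: "feedback_composable C S2"
    and Q: "(x1, x2) \<in> Q" and out: "((xc, x2), (u, vc)) \<in> out_map C"
    and block: "trans_map S1 `` {(x1, u)} = {}"
  shows "trans_map C `` {(xc, vc)} = {}"
proof -
  have "u \<in> inputs S2"
    using comp system_out_mapD(3)[OF _ out] by (auto simp: feedback_composable_def)
  moreover have "x2 \<in> states S2" "simple S2"
    using ref Q by (auto simp: feedback_refinement_def strict_map_def)
  ultimately show ?thesis
    using composable_simple_blocked[OF comp _ out] refinement_blocked[OF ref Q] block by blast
qed

lemma composable_is_system: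
  assumes "feedback_composable A B"
  shows "is_system A" and "is_system B"
  using assms by (simp_all add: feedback_composable_def)

lemma composable_quantize_output:
  assumes ref: "feedback_refinement Q S1 S2" and comp: "feedback_composable C S2"
  shows "feedback_composable C (quantize_output (states S2) Q S1)"
proof -
  let ?P = "quantize_output (states S2) Q S1"
  have S: "simple S1" "simple S2" "strict_map (states S1) (states S2) Q" "inputs S2 \<subseteq> inputs S1"
    using ref by (auto simp: feedback_refinement_def)
  have "is_system ?P"
    using S by (intro is_system_quantize_output) (auto simp: simple_def is_system_def)
  moreover have "outputs ?P \<subseteq> inputs C" "outputs C \<subseteq> inputs ?P"
    using comp S by (auto simp: feedback_composable_def quantize_output_def simple_def)
  moreover have "is_system C"
    using comp by (simp add: feedback_composable_def)
  moreover have "\<forall>xc x1 u y2 vc v2. (y2, v2) \<in> out_map ?P `` {(x1, u)} \<and>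
      (u, vc) \<in> out_map C `` {(xc, y2)} \<and> trans_map ?P `` {(x1, v2)} = {} \<longrightarrow>
      trans_map C `` {(xc, vc)} = {}"
  proof (intro allI impI, elim conjE)
    fix xc x1 u y2 vc v2
    assume P: "(y2, v2) \<in> out_map ?P `` {(x1, u)}" "trans_map ?P `` {(x1, v2)} = {}"
      and C: "(u, vc) \<in> out_map C `` {(xc, y2)}"
    from P have "(x1, y2) \<in> Q" "trans_map S1 `` {(x1, u)} = {}"
      by (simp_all add: quantize_output_def)
    with C show "trans_map C `` {(xc, vc)} = {}"
      by (simp only: Image_singleton_iff refinement_composable_blocked[OF ref comp])
  qed
  ultimately show ?thesis
    by (simp only: feedback_composable_def moore_quantize_output simp_thms)
qed

lemma composable_quantize_input:
  assumes ref: "feedback_refinement Q S1 S2" and comp: "feedback_composable C S2"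
  shows "feedback_composable (quantize_input C (states S1) Q) S1"
proof -
  let ?K = "quantize_input C (states S1) Q"
  have S: "simple S1" "simple S2" "strict_map (states S1) (states S2) Q" "inputs S2 \<subseteq> inputs S1"
    using ref by (auto simp: feedback_refinement_def)
  have C: "is_system C" "states S2 \<subseteq> inputs C" "outputs C \<subseteq> inputs S2"
    using comp S by (auto simp: feedback_composable_def simple_def)
  have "is_system ?K"
    using S C strict_map_mono[OF S(3) C(2)]
    by (intro is_system_quantize_input) (auto simp: simple_def is_system_def)
  moreover have "outputs S1 \<subseteq> inputs ?K" "outputs ?K \<subseteq> inputs S1"
    using C S by (auto simp: quantize_input_def simple_def)
  moreover have "is_system S1" "moore S1"
    using S(1) moore_simple[OF S(1)] by (simp_all add: simple_def)
  moreover have "\<forall>xc x1 u x1' vc v1. (x1', v1) \<in> out_map S1 `` {(x1, u)} \<and>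
      (u, vc) \<in> out_map ?K `` {(xc, x1')} \<and> trans_map S1 `` {(x1, v1)} = {} \<longrightarrow>
      trans_map ?K `` {(xc, vc)} = {}"
  proof (intro allI impI, elim conjE)
    fix xc x1 u x1' vc v1
    assume S1: "(x1', v1) \<in> out_map S1 `` {(x1, u)}" "trans_map S1 `` {(x1, v1)} = {}"
      and K: "(u, vc) \<in> out_map ?K `` {(xc, x1')}"
    from S1 have eq: "x1' = x1" and block: "trans_map S1 `` {(x1, u)} = {}"
      by (simp_all only: simple_out_map[OF S(1)] Image_singleton_iff Id_on_iff prod.inject)
    from K eq obtain x2 where "(x1, x2) \<in> Q" "((xc, x2), (u, vc)) \<in> out_map C"
      by (auto simp: quantize_input_def)
    with block show "trans_map ?K `` {(xc, vc)} = {}"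
      using refinement_composable_blocked[OF ref comp] by (simp add: quantize_input_def)
  qed
  ultimately show ?thesis
    by (simp only: feedback_composable_def simp_thms)
qed

section \<open>Transfer of runs\<close>

text \<open>
  The quantized plant output becomes the state trajectory of the abstract plant. Each successor of
  the concrete state offers the quantizer a set of abstract states, all of which have to be
  successors in the abstraction, since the quantizer is free to pick any of them; this is why the
  refinement relation requires an inclusion of the whole set.
\<close>

lemma loop_run_abstract:
  assumes ref: "feedback_refinement Q S1 S2" and comp: "feedback_composable C S2"
    and run: "loop_run C (quantize_output (states S2) Q S1) T xc x1 vc v yc x2"
  shows "loop_run C S2 T xc x2 vc v yc x2"
proof -
  let ?P = "quantize_output (states S2) Q S1"
  have S: "simple S2" "Q \<subseteq> states S1 \<times> states S2"
    using ref by (auto simp: feedback_refinement_def strict_map_def)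
  have C: "is_system C" "outputs C \<subseteq> inputs S2"
    using comp by (auto simp: feedback_composable_def)
  have outC: "((xc t, x2 t), (yc t, vc t)) \<in> out_map C" and Q: "(x1 t, x2 t) \<in> Q"
    and v: "v t = yc t" if "enat t < T" for t
    using run that by (auto simp: loop_run_def quantize_output_def)
  have yc: "yc t \<in> inputs S2" if "enat t < T" for t
    using system_out_mapD(3)[OF C(1) outC[OF that]] C(2) by blast
  have T: "T \<noteq> 0" using run by (simp add: loop_run_def)
  hence "x2 0 \<in> init S2"
    using Q[of 0] S by (auto simp: simple_def zero_enat_def[symmetric])
  moreover have "((x2 t, v t), x2 (Suc t)) \<in> trans_map S2" if t: "enat (Suc t) < T" for t
  proof -
    note t' = enat_Suc_lessD[OF t]
    have step: "((xc t, vc t), xc (Suc t)) \<in> trans_map C"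
      "((x1 t, v t), x1 (Suc t)) \<in> trans_map S1"
      using run t by (auto simp: loop_run_def quantize_output_def)
    \<comment> \<open>The controller moves, so by composability the abstract plant is not blocked.\<close>
    have "trans_map S2 `` {(x2 t, yc t)} \<noteq> {}"
      using composable_simple_blocked[OF comp S(1) outC[OF t']] Q[OF t'] S step(1) by blast
    hence "yc t \<in> admissible S2 (x2 t)"
      using yc[OF t'] by (simp add: admissible_def)
    hence "Q `` (trans_map S1 `` {(x1 t, yc t)}) \<subseteq> trans_map S2 `` {(x2 t, yc t)}"
      using ref Q[OF t'] unfolding feedback_refinement_def by blast
    thus ?thesis
      using step(2) Q[OF t] v[OF t'] by auto
  qed
  moreover have "((x2 t, yc t), (x2 t, v t)) \<in> out_map S2" if "enat t < T" for t
    using Q[OF that] S yc[OF that] v[OF that] by (auto simp: simple_out_map)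
  moreover have "trans_map C `` {(xc n, vc n)} = {}" if n: "T = enat (Suc n)" for n
  proof -
    have n': "enat n < T" using n by simp
    have "trans_map C `` {(xc n, vc n)} = {} \<or> trans_map S1 `` {(x1 n, yc n)} = {}"
      using run n v[OF n'] by (auto simp: loop_run_def quantize_output_def)
    thus ?thesis
      using refinement_composable_blocked[OF ref comp Q[OF n'] outC[OF n']] by blast
  qed
  ultimately show ?thesis
    using run T by (simp add: loop_run_def)
qed

text \<open>
  The quantizer at the controller input may have produced several abstract states; the output
  map of the composition guarantees, at each time, one that makes the controller emit the recorded
  output. That state becomes the recorded plant output; the plant itself, which sees only the
  controller output, is unaffected by the choice.
\<close>

lemma loop_run_move_quantizer:
  assumes simple: "simple S"
    and run: "loop_run (quantize_input C (states S) Q) S T xc x vc v yc y"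
  obtains q where "loop_run C (quantize_output X' Q S) T xc x vc v yc q"
    and "\<forall>t. enat t < T \<longrightarrow> (y t, q t) \<in> Q"
proof -
  have "\<exists>q. enat t < T \<longrightarrow> (y t, q) \<in> Q \<and> ((xc t, q), (yc t, vc t)) \<in> out_map C" for t
    using run by (auto simp: loop_run_def quantize_input_def)
  then obtain q where q: "\<And>t. enat t < T \<Longrightarrow> (y t, q t) \<in> Q"
    "\<And>t. enat t < T \<Longrightarrow> ((xc t, q t), (yc t, vc t)) \<in> out_map C"
    by metis
  have "y t = x t" "v t = yc t" "x t \<in> states S" "yc t \<in> inputs S" if "enat t < T" for t
    using run that by (auto simp: loop_run_def simple_out_map[OF simple])
  hence "loop_run C (quantize_output X' Q S) T xc x vc v yc q"
    using run q simple by (simp add: loop_run_def quantize_input_def quantize_output_def simple_def)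
  with q(1) that show ?thesis by blast
qed

theorem theoremV4:
  fixes S1 :: "('x1, 'u, 'u, 'x1) system"
    and S2 :: "('x2, 'u, 'u, 'x2) system"
    and C :: "('xc, 'x2, 'vc, 'u) system"
    and Q :: "('x1 \<times> 'x2) set"
  assumes "simple S1"
    and "simple S2"
    and "feedback_refinement Q S1 S2"
    and "is_system C"
    and "feedback_composable C S2"
  shows "(feedback_composable C (quantize_output (states S2) Q S1) \<and>
          feedback_composable (quantize_input C (states S1) Q) S1) \<and>
         behavior (closed_loop C (quantize_output (states S2) Q S1))
           \<subseteq> behavior (closed_loop C S2) \<and>
         (\<forall>(u, x1) \<in> loop_behavior (quantize_input C (states S1) Q) S1.
            \<exists>x2. (u, x2) \<in> loop_behavior C S2 \<and>
              (\<forall>t\<in>dom x1. \<exists>a b. x1 t = Some a \<and> x2 t = Some b \<and> (a, b) \<in> Q))"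
proof (intro conjI)
  let ?P = "quantize_output (states S2) Q S1" and ?K = "quantize_input C (states S1) Q"
  note ref = assms(3) and comp = assms(5)
  show P: "feedback_composable C ?P"
    using composable_quantize_output[OF ref comp] .
  show K: "feedback_composable ?K S1"
    using composable_quantize_input[OF ref comp] .
  note sys_abstract = composable_is_system[OF comp] and sys_P = composable_is_system[OF P]
    and sys_K = composable_is_system[OF K]
  note abstract = loop_run_imp_behavior[OF sys_abstract loop_run_abstract[OF ref comp]]
  show "behavior (closed_loop C ?P) \<subseteq> behavior (closed_loop C S2)"
  proof (rule subrelI)
    fix w z assume "(w, z) \<in> behavior (closed_loop C ?P)"
    then show "(w, z) \<in> behavior (closed_loop C S2)"
      by (rule behavior_imp_loop_run[OF sys_P]) (simp only: abstract)
  qed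
  show "\<forall>(u, x1) \<in> loop_behavior ?K S1. \<exists>x2. (u, x2) \<in> loop_behavior C S2 \<and>
          (\<forall>t\<in>dom x1. \<exists>a b. x1 t = Some a \<and> x2 t = Some b \<and> (a, b) \<in> Q)"
  proof clarify
    fix u x1 assume "(u, x1) \<in> loop_behavior ?K S1"
    then obtain w z where beh: "(w, z) \<in> behavior (closed_loop ?K S1)"
      and eq: "u = map_option fst \<circ> z" "x1 = map_option snd \<circ> z"
      unfolding loop_behavior_def by blast
    obtain T xc x vc v yc y where run: "loop_run ?K S1 T xc x vc v yc y"
      and z: "z = signal T (\<lambda>t. (yc t, y t))"
      by (rule behavior_imp_loop_run[OF sys_K beh])
    obtain q where q: "loop_run C ?P T xc x vc v yc q" "\<forall>t. enat t < T \<longrightarrow> (y t, q t) \<in> Q"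
      by (rule loop_run_move_quantizer[OF assms(1) run, where X' = "states S2"])
    have "(map_option fst \<circ> signal T (\<lambda>t. (yc t, q t)), map_option snd \<circ> signal T (\<lambda>t. (yc t, q t)))
          \<in> loop_behavior C S2"
      unfolding loop_behavior_def using abstract[OF q(1)] by blast
    hence "(u, signal T q) \<in> loop_behavior C S2"
      unfolding eq z map_option_signal by (simp add: o_def)
    moreover have "\<forall>t\<in>dom x1. \<exists>a b. x1 t = Some a \<and> signal T q t = Some b \<and> (a, b) \<in> Q"
      using q(2) by (auto simp: eq z signal_def split: if_splits)
    ultimately show "\<exists>x2. (u, x2) \<in> loop_behavior C S2 \<and>
        (\<forall>t\<in>dom x1. \<exists>a b. x1 t = Some a \<and> x2 t = Some b \<and> (a, b) \<in> Q)"
      by blast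
  qed
qed

end
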